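(* Let $\hbar>0$ and let $n\ge 1$ be an integer. For the projection $p_n = g_n(u+\hbar)W+f_n(u)+g_n(u)W^{-1}\in\mathcal{C}_\hbar^\infty$ (with $f_n,g_n$ as defined in the context) one has $\Psi(p_n,p_n,p_n)=n$, where $$\Psi(a_0,a_1,a_2)=\frac{1}{2\pi i}\tau\big(a_0(\partial_1a_1)(\partial_2a_2)-a_0(\partial_2a_1)(\partial_1a_2)\big),\qquad a_0,a_1,a_2\in\mathcal{C}_\hbar^\infty.$$
   Context: Let $\mathcal{S}(\mathbb{R}\times S^1)$ ($S^1=\mathbb{R}/\mathbb{Z}$) be the Schwartz functions on $\mathbb{R}\times S^1$; with $W=e^{2\pi i t}$, each is written $f(u,t)=\sum_{n\in\mathbb{Z}}f_n(u)W^n$ with $f_n\in\mathcal{S}(\mathbb{R})$. The algebra $\mathcal{C}_\hbar^\infty$ is this vector space with the product $fg=\sum_{n}\big[\sum_{k}f_k(u)g_{n-k}(u+k\hbar)\big]W^n$ (so $W^nf(u)=f(u+n\hbar)W^n$) and involution $f^*=\sum_n\overline{f_{-n}(u+n\hbar)}W^n$. Derivations: $\partial_1f=\sum_nf_n'(u)W^n$ and $\partial_2f=2\pi i\sum_n nf_n(u)W^n$. Trace: $\tau(f)=\int_{-\infty}^{\infty}f_0(u)\,du$, where $f_0$ is the coefficient of $W^0$. Construction of $p_n$. Let $\phi_0$ be a function increasing smoothly from $0$ to $1$ on $[0,\hbar]$, and define $f,g:\mathbb{R}\to\mathbb{R}$ by: $f(u)=0$ if $u\le 0$ or $u\ge 2\hbar$,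 $f(u)=\phi_0(u)$ if $0\le u\le\hbar$, $f(u)=1-\phi_0(u-\hbar)$ if $\hbar\le u\le 2\hbar$; $g(u)=0$ if $u\le\hbar$ or $u\ge 2\hbar$, $g(u)=\sqrt{f(u)-f(u)^2}$ if $\hbar\le u\le 2\hbar$. The function $\phi_0$ is assumed chosen so that $f$ and $g$ are smooth on $\mathbb{R}$. For $n\ge1$ set $f_n(u)=\sum_{k=1}^nW^{-2k}f(u)W^{2k}=\sum_{k=1}^nf(u-2k\hbar)$ and $g_n(u)=\sum_{k=1}^nW^{-2k}g(u)W^{2k}=\sum_{k=1}^ng(u-2k\hbar)$. *)

theory Defs
  imports "HOL-Analysis.Analysis"
begin

text \<open>On an interval \<open>S\<close> this is smoothness up to the boundary (one-sided derivatives at the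
  endpoints).\<close>

definition smooth_on :: "real set \<Rightarrow> (real \<Rightarrow> real) \<Rightarrow> bool" where
  "smooth_on S f \<longleftrightarrow> (\<exists>D :: nat \<Rightarrow> real \<Rightarrow> real.
     D 0 = f \<and>
     (\<forall>k. \<forall>x\<in>S. (D k has_real_derivative D (Suc k) x) (at x within S)))"

text \<open>A function on \<open>\<real> \<times> S\<^sup>1\<close>, where \<open>S\<^sup>1 = \<real>/\<int>\<close>, is a function of \<open>(u, t)\<close> that is 1-periodic
  in \<open>t\<close>. In the definition below \<open>D b c\<close> is the mixed partial derivative of order \<open>b\<close> in \<open>u\<close>
  and \<open>c\<close> in \<open>t\<close>. The algebra \<open>C\<^sub>\<hbar>\<^sup>\<infinity>\<close> has this space as its underlying vector space;
  only the product and the involution depend on \<open>\<hbar>\<close>.\<close>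

type_synonym cyl = "real \<Rightarrow> real \<Rightarrow> complex"

definition schwartz_cyl :: "cyl set" where
  "schwartz_cyl = {F. (\<forall>u t. F u (t + 1) = F u t) \<and>
     (\<exists>D :: nat \<Rightarrow> nat \<Rightarrow> cyl. D 0 0 = F \<and>
        (\<forall>b c u t. ((\<lambda>(x, y). D b c x y) has_derivative
            (\<lambda>(k, l). k *\<^sub>R D (Suc b) c u t + l *\<^sub>R D b (Suc c) u t)) (at (u, t))) \<and>
        (\<forall>a b c. \<exists>C. \<forall>u t. \<bar>u\<bar> ^ a * norm (D b c u t) \<le> C))}"

definition W :: "real \<Rightarrow> complex" where
  "W t = exp (2 * complex_of_real pi * \<i> * complex_of_real t)"

definition coef :: "cyl \<Rightarrow> int \<Rightarrow> real \<Rightarrow> complex" where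
  "coef F n u = (LINT t:{0..1}|lborel. F u t * W t powi (- n))"

definition fourier_sum :: "(int \<Rightarrow> real \<Rightarrow> complex) \<Rightarrow> cyl" where
  "fourier_sum c = (\<lambda>u t. \<Sum>\<^sub>\<infinity>n. c n u * W t powi n)"

definition cprod :: "real \<Rightarrow> cyl \<Rightarrow> cyl \<Rightarrow> cyl" where
  "cprod h F G = fourier_sum
     (\<lambda>n u. \<Sum>\<^sub>\<infinity>k. coef F k u * coef G (n - k) (u + of_int k * h))"

definition cstar :: "real \<Rightarrow> cyl \<Rightarrow> cyl" where
  "cstar h F = fourier_sum (\<lambda>n u. cnj (coef F (- n) (u + of_int n * h)))"

definition is_projection :: "real \<Rightarrow> cyl \<Rightarrow> bool" where
  "is_projection h P \<longleftrightarrow> P \<in> schwartz_cyl \<and> cprod h P P = P \<and> cstar h P = P"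

definition deriv1 :: "cyl \<Rightarrow> cyl" where
  "deriv1 F = fourier_sum (\<lambda>n u. vector_derivative (coef F n) (at u))"

definition deriv2 :: "cyl \<Rightarrow> cyl" where
  "deriv2 F = (\<lambda>u t. 2 * complex_of_real pi * \<i> *
     fourier_sum (\<lambda>n u. of_int n * coef F n u) u t)"

definition tau :: "cyl \<Rightarrow> complex" where
  "tau F = (LINT u|lborel. coef F 0 u)"

definition Psi :: "real \<Rightarrow> cyl \<Rightarrow> cyl \<Rightarrow> cyl \<Rightarrow> complex" where
  "Psi h A0 A1 A2 = 1 / (2 * complex_of_real pi * \<i>) *
     tau (cprod h (cprod h A0 (deriv1 A1)) (deriv2 A2)
          - cprod h (cprod h A0 (deriv2 A1)) (deriv1 A2))"

definition bump_f :: "real \<Rightarrow> (real \<Rightarrow> real) \<Rightarrow> real \<Rightarrow> real" where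
  "bump_f h \<phi> u = (if u \<le> 0 \<or> u \<ge> 2 * h then 0
     else if u \<le> h then \<phi> u else 1 - \<phi> (u - h))"

definition bump_g :: "real \<Rightarrow> (real \<Rightarrow> real) \<Rightarrow> real \<Rightarrow> real" where
  "bump_g h \<phi> u = (if u \<le> h \<or> u \<ge> 2 * h then 0
     else sqrt (bump_f h \<phi> u - (bump_f h \<phi> u)\<^sup>2))"

text \<open>In \<open>sum_f\<close> and \<open>sum_g\<close> the \<open>k\<close>-th term is the conjugate \<open>W\<^sup>-\<^sup>2\<^sup>k f W\<^sup>2\<^sup>k\<close>, evaluated
  with the commutation rule \<open>W\<^sup>m f(u) = f(u + m \<hbar>) W\<^sup>m\<close>.\<close>

definition sum_f :: "real \<Rightarrow> (real \<Rightarrow> real) \<Rightarrow> nat \<Rightarrow> real \<Rightarrow> real" where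
  "sum_f h \<phi> n u = (\<Sum>k=1..n. bump_f h \<phi> (u - 2 * real k * h))"

definition sum_g :: "real \<Rightarrow> (real \<Rightarrow> real) \<Rightarrow> nat \<Rightarrow> real \<Rightarrow> real" where
  "sum_g h \<phi> n u = (\<Sum>k=1..n. bump_g h \<phi> (u - 2 * real k * h))"

text \<open>A function of \<open>u\<close> written to the left of a power of \<open>W\<close> is that Fourier coefficient, so
  the products below are pointwise; \<open>W\<close> itself is not a Schwartz function.\<close>

definition proj_p :: "real \<Rightarrow> (real \<Rightarrow> real) \<Rightarrow> nat \<Rightarrow> cyl" where
  "proj_p h \<phi> n = (\<lambda>u t.
     complex_of_real (sum_g h \<phi> n (u + h)) * W t
     + complex_of_real (sum_f h \<phi> n u)
     + complex_of_real (sum_g h \<phi> n u) * W t powi (- 1))"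

end

theory Submission
  imports Defs
begin

text \<open>All elements involved have finitely many Fourier coefficients, so products are finite twisted
  convolutions. With \<open>F = f\<^sub>n\<close> and \<open>G = g\<^sub>n\<close>, the projection equation amounts to
  \<open>G(u) (F(u) + F(u - \<hbar>)) = G(u)\<close>, \<open>G(u) G(u + \<hbar>) = 0\<close> and
  \<open>F(u)\<^sup>2 + G(u + \<hbar>)\<^sup>2 + G(u)\<^sup>2 = F(u)\<close>. Expanding the cyclic cocycle and translating by \<open>\<hbar>\<close>
  gives \<open>\<Psi> = \<integral> (E (G\<^sup>2)' - 2 G\<^sup>2 E')\<close> with \<open>E(u) = F(u) - F(u - \<hbar>)\<close>. Integrating by parts and
  using \<open>E' = 2 F'\<close> on the support of \<open>G\<close>, this is \<open>- 6 \<integral> G\<^sup>2 F'\<close>, which is computed block by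
  block.\<close>

section \<open>Powers of \<open>W\<close> and their orthogonality over a period\<close>

lemma W_powi: "W t powi k = exp (\<i> * complex_of_real (2 * pi * of_int k * t))"
  by (simp add: W_def exp_power_int mult_ac)

lemma W_nonzero [simp]: "W t \<noteq> 0"
  by (simp add: W_def)

lemma W_shift: "W (t + 1) = W t"
  by (simp add: W_def distrib_left exp_add)

lemma has_vector_derivative_W_powi:
  "((\<lambda>t. W t powi k) has_vector_derivative 2 * pi * \<i> * of_int k * W t powi k) (at t within S)"
proof -
  have "((\<lambda>t. 2 * pi * of_int k * t) has_real_derivative 2 * pi * of_int k) (at t within S)"
    by (auto intro!: derivative_eq_intros)
  then have "((\<lambda>t. \<i> * of_real (2 * pi * of_int k * t)) has_vector_derivative
      \<i> * of_real (2 * pi * of_int k)) (at t within S)"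
    by (intro has_vector_derivative_mult_right has_vector_derivative_of_real)
  from field_vector_diff_chain_within[OF this has_field_derivative_at_within[OF DERIV_exp]]
  show ?thesis
    unfolding W_powi o_def by (simp add: mult_ac)
qed

lemma continuous_on_W_powi: "continuous_on S (\<lambda>t. W t powi k)"
  using has_vector_derivative_W_powi has_vector_derivative_continuous
  by (fastforce simp: continuous_on_eq_continuous_within)

text \<open>For nonzero \<open>k\<close> the antiderivative is a multiple of the same 1-periodic
  function, so its endpoint values cancel: orthogonality of characters.\<close>

lemma integral_W_powi: "(LINT t:{0..1}|lborel. W t powi k) = (if k = 0 then 1 else 0)"
proof (cases "k = 0")
  case True
  then show ?thesis by (simp add: set_lebesgue_integral_def)
next
  case False
  let ?A = "\<lambda>t. W t powi k / (2 * pi * \<i> * of_int k)"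
  have "(?A has_vector_derivative W t powi k) (at t within {0..1})" for t
    using has_vector_derivative_mult_right[OF has_vector_derivative_W_powi,
        of "1 / (2 * pi * \<i> * of_int k)" k t "{0..1}"] False
    by simp
  then have "(LINT t:{0..1}|lborel. W t powi k) = ?A 1 - ?A 0"
    unfolding set_lebesgue_integral_def
    by (intro integral_FTC_Icc continuous_on_W_powi) auto
  then show ?thesis using False W_shift[of 0] by simp
qed

section \<open>Finite Fourier sums and the algebra operations on them\<close>

definition band_limited :: "int \<Rightarrow> (int \<Rightarrow> real \<Rightarrow> complex) \<Rightarrow> bool" where
  "band_limited N a \<longleftrightarrow> (\<forall>m u. N < \<bar>m\<bar> \<longrightarrow> a m u = 0)"

lemma band_limitedD: "band_limited N a \<Longrightarrow> m \<notin> {-N..N} \<Longrightarrow> a m u = 0"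
  unfolding band_limited_def by force

lemma fourier_sum_band_limited:
  assumes "band_limited N a"
  shows "fourier_sum a = (\<lambda>u t. \<Sum>m\<in>{-N..N}. a m u * W t powi m)"
proof (intro ext)
  fix u t
  have "infsum (\<lambda>m. a m u * W t powi m) UNIV = infsum (\<lambda>m. a m u * W t powi m) {-N..N}"
    by (rule infsum_cong_neutral) (use band_limitedD[OF assms] in auto)
  then show "fourier_sum a u t = (\<Sum>m\<in>{-N..N}. a m u * W t powi m)"
    by (simp add: fourier_sum_def)
qed

text \<open>Orthogonality isolates the term \<open>m = n\<close>. Product, involution, derivations
  and trace are all defined through \<open>coef\<close>, so this reduces them to operations on
  coefficient families.\<close>

lemma coef_fourier_sum:
  assumes "band_limited N a"
  shows "coef (fourier_sum a) = a"
proof (intro ext)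
  fix n u
  have "coef (fourier_sum a) n u =
      (LINT t:{0..1}|lborel. \<Sum>m\<in>{-N..N}. a m u * W t powi (m - n))"
    unfolding coef_def fourier_sum_band_limited[OF assms]
    by (simp add: sum_distrib_right power_int_diff power_int_minus divide_inverse mult.assoc)
  also have "\<dots> = (\<Sum>m\<in>{-N..N}. LINT t:{0..1}|lborel. a m u * W t powi (m - n))"
    unfolding set_lebesgue_integral_def scaleR_sum_right
    by (intro Bochner_Integration.integral_sum borel_integrable_compact continuous_intros
        continuous_on_W_powi) auto
  also have "\<dots> = (\<Sum>m\<in>{-N..N}. if m = n then a m u else 0)"
    by (intro sum.cong) (auto simp: integral_W_powi)
  also have "\<dots> = a n u"
    using band_limitedD[OF assms, of n u] by (simp del: atLeastAtMost_iff)
  finally show "coef (fourier_sum a) n u = a n u" .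
qed

text \<open>The product rule coming from \<open>W^k b(u) = b(u + k h) W^k\<close>. The cut-off
  \<open>N\<close> is meant to bound the degrees of the left factor, so that truncation loses
  nothing.\<close>

definition twisted_conv ::
  "real \<Rightarrow> int \<Rightarrow> (int \<Rightarrow> real \<Rightarrow> complex) \<Rightarrow> (int \<Rightarrow> real \<Rightarrow> complex) \<Rightarrow> int \<Rightarrow> real \<Rightarrow> complex" where
  "twisted_conv h N a b n u = (\<Sum>k\<in>{-N..N}. a k u * b (n - k) (u + of_int k * h))"

lemma band_limited_twisted_conv:
  assumes "band_limited M b"
  shows "band_limited (N + M) (twisted_conv h N a b)"
  using assms unfolding band_limited_def twisted_conv_def by (auto intro!: sum.neutral)

lemma cprod_fourier_sum:
  assumes a: "band_limited N a" and b: "band_limited M b"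
  shows "cprod h (fourier_sum a) (fourier_sum b) = fourier_sum (twisted_conv h N a b)"
proof -
  have "(\<Sum>\<^sub>\<infinity>k. a k u * b (n - k) (u + of_int k * h)) = twisted_conv h N a b n u" for n u
  proof -
    have "(\<Sum>\<^sub>\<infinity>k. a k u * b (n - k) (u + of_int k * h)) =
        infsum (\<lambda>k. a k u * b (n - k) (u + of_int k * h)) {-N..N}"
      by (rule infsum_cong_neutral) (use band_limitedD[OF a] in auto)
    then show ?thesis by (simp add: twisted_conv_def)
  qed
  then show ?thesis
    unfolding cprod_def coef_fourier_sum[OF a] coef_fourier_sum[OF b] by simp
qed

lemma fourier_sum_diff:
  assumes "band_limited N a" "band_limited N b"
  shows "fourier_sum a - fourier_sum b = fourier_sum (\<lambda>n u. a n u - b n u)"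
proof -
  have "band_limited N (\<lambda>n u. a n u - b n u)"
    using assms by (simp add: band_limited_def)
  note eqs = fourier_sum_band_limited[OF assms(1)] fourier_sum_band_limited[OF assms(2)]
    fourier_sum_band_limited[OF this]
  show ?thesis
    unfolding eqs by (simp add: fun_eq_iff left_diff_distrib sum_subtractf)
qed

lemma deriv1_fourier_sum:
  assumes "band_limited N a" "\<And>n u. (a n has_vector_derivative a' n u) (at u)"
  shows "deriv1 (fourier_sum a) = fourier_sum a'"
  using vector_derivative_at[OF assms(2)]
  unfolding deriv1_def coef_fourier_sum[OF assms(1)] by simp

lemma deriv2_fourier_sum:
  assumes "band_limited N a"
  shows "deriv2 (fourier_sum a) = fourier_sum (\<lambda>n u. 2 * pi * \<i> * of_int n * a n u)"
proof -
  have "band_limited N (\<lambda>n u. of_int n * a n u)" "band_limited N (\<lambda>n u. 2 * pi * \<i> * of_int n * a n u)"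
    using assms by (simp_all add: band_limited_def)
  then show ?thesis
    unfolding deriv2_def coef_fourier_sum[OF assms]
    by (simp add: fourier_sum_band_limited sum_distrib_left mult_ac)
qed

lemma cstar_fourier_sum:
  assumes "band_limited N a"
  shows "cstar h (fourier_sum a) = fourier_sum (\<lambda>n u. cnj (a (- n) (u + of_int n * h)))"
  unfolding cstar_def coef_fourier_sum[OF assms] ..

section \<open>Smooth functions of compact support\<close>

definition test_function :: "(real \<Rightarrow> real) \<Rightarrow> bool" where
  "test_function f \<longleftrightarrow> (\<exists>D R. D 0 = f \<and>
     (\<forall>k x. (D k has_real_derivative D (Suc k) x) (at x)) \<and> (\<forall>k x. R < \<bar>x\<bar> \<longrightarrow> D k x = (0::real)))"

text \<open>The set where \<open>R < \<bar>x\<bar>\<close> is open, so a function vanishing there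
  has derivative zero there. By induction one \<open>R\<close> serves all orders.\<close>

lemma test_functionI:
  assumes "smooth_on UNIV f" and zero: "\<And>x. R < \<bar>x\<bar> \<Longrightarrow> f x = 0"
  shows "test_function f"
proof -
  obtain D where D: "D 0 = f" "\<And>k x. (D k has_real_derivative D (Suc k) x) (at x)"
    using assms(1) unfolding smooth_on_def by auto
  have "\<forall>x. R < \<bar>x\<bar> \<longrightarrow> D k x = 0" for k
  proof (induction k)
    case 0
    then show ?case using D(1) zero by simp
  next
    case (Suc k)
    show ?case
    proof (intro allI impI)
      fix x assume x: "R < \<bar>x\<bar>"
      have op: "open {x::real. R < \<bar>x\<bar>}"
        by (intro open_Collect_less continuous_intros)
      have "(D k has_real_derivative 0) (at x)"
        by (rule has_field_derivative_transform_within_open[OF DERIV_const op])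
          (use x Suc in auto)
      then show "D (Suc k) x = 0"
        using D(2) DERIV_unique by blast
    qed
  qed
  then show ?thesis using D unfolding test_function_def by blast
qed

text \<open>Extracts the continuously differentiable data on which the integration by parts
  operates.\<close>

lemma test_functionE:
  assumes "test_function f"
  obtains f' R where "\<And>x. (f has_real_derivative f' x) (at x)" "continuous_on UNIV f'"
    "\<And>x. R < \<bar>x\<bar> \<Longrightarrow> f x = 0" "\<And>x. R < \<bar>x\<bar> \<Longrightarrow> f' x = 0"
proof -
  obtain D R where D: "D 0 = f" "\<And>k x. (D k has_real_derivative D (Suc k) x) (at x)"
    "\<And>k x. R < \<bar>x\<bar> \<Longrightarrow> D k x = 0"
    using assms unfolding test_function_def by auto
  show ?thesis
    by (rule that[of "D 1" R])
      (use D(1) D(2)[of 0] D(2)[of 1] D(3)[of _ 0] D(3)[of _ 1] in \<open>auto intro: DERIV_continuous_on\<close>)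
qed

lemma test_function_0: "test_function (\<lambda>x. 0)"
  by (rule test_functionI[of _ 0]) (auto simp: smooth_on_def intro!: exI[of _ "\<lambda>k x. 0"])

lemma test_function_shift:
  assumes "test_function f"
  shows "test_function (\<lambda>x. f (x + c))"
proof -
  obtain D R where D: "D 0 = f" "\<And>k x. (D k has_real_derivative D (Suc k) x) (at x)"
    "\<And>k x. R < \<bar>x\<bar> \<Longrightarrow> D k x = 0"
    using assms unfolding test_function_def by auto
  have "((\<lambda>x. D k (x + c)) has_real_derivative D (Suc k) (x + c)) (at x)" for k x
    using D(2)[of k "x + c"] by (simp add: DERIV_shift)
  moreover have "D k (x + c) = 0" if "R + \<bar>c\<bar> < \<bar>x\<bar>" for k x
    by (rule D(3)) (use that in linarith)
  ultimately show ?thesis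
    unfolding test_function_def using D(1)
    by (intro exI[of _ "\<lambda>k x. D k (x + c)"] exI[of _ "R + \<bar>c\<bar>"]) auto
qed

lemma test_function_add:
  assumes "test_function f" "test_function g"
  shows "test_function (\<lambda>x. f x + g x)"
proof -
  obtain D R where D: "D 0 = f" "\<And>k x. (D k has_real_derivative D (Suc k) x) (at x)"
    "\<And>k x. R < \<bar>x\<bar> \<Longrightarrow> D k x = 0"
    using assms unfolding test_function_def by auto
  obtain E S where E: "E 0 = g" "\<And>k x. (E k has_real_derivative E (Suc k) x) (at x)"
    "\<And>k x. S < \<bar>x\<bar> \<Longrightarrow> E k x = 0"
    using assms unfolding test_function_def by auto
  show ?thesis
    unfolding test_function_def using D E
    by (intro exI[of _ "\<lambda>k x. D k x + E k x"] exI[of _ "max R S"]) (auto intro: DERIV_add)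
qed

lemma test_function_sum:
  assumes "\<And>i. i \<in> I \<Longrightarrow> test_function (f i)"
  shows "test_function (\<lambda>x. \<Sum>i\<in>I. f i x)"
  using assms
  by (induction I rule: infinite_finite_induct) (simp_all add: test_function_0 test_function_add)

section \<open>Membership in the Schwartz space of the cylinder\<close>

lemma schwartz_cyl_add:
  assumes "F \<in> schwartz_cyl" "G \<in> schwartz_cyl"
  shows "(\<lambda>u t. F u t + G u t) \<in> schwartz_cyl"
proof -
  obtain D where D: "\<And>u t. F u (t + 1) = F u t" "D 0 0 = F"
      "\<And>b c u t. ((\<lambda>(x, y). D b c x y) has_derivative
            (\<lambda>(k, l). k *\<^sub>R D (Suc b) c u t + l *\<^sub>R D b (Suc c) u t)) (at (u, t))"
      "\<And>a b c. \<exists>C. \<forall>u t. \<bar>u\<bar> ^ a * norm (D b c u t) \<le> C"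
    using assms(1) unfolding schwartz_cyl_def by blast
  obtain E where E: "\<And>u t. G u (t + 1) = G u t" "E 0 0 = G"
      "\<And>b c u t. ((\<lambda>(x, y). E b c x y) has_derivative
            (\<lambda>(k, l). k *\<^sub>R E (Suc b) c u t + l *\<^sub>R E b (Suc c) u t)) (at (u, t))"
      "\<And>a b c. \<exists>C. \<forall>u t. \<bar>u\<bar> ^ a * norm (E b c u t) \<le> C"
    using assms(2) unfolding schwartz_cyl_def by blast
  have "((\<lambda>(x, y). D b c x y + E b c x y) has_derivative
      (\<lambda>(k, l). k *\<^sub>R (D (Suc b) c u t + E (Suc b) c u t)
        + l *\<^sub>R (D b (Suc c) u t + E b (Suc c) u t))) (at (u, t))" for b c u t
    using has_derivative_add[OF D(3)[of b c u t] E(3)[of b c u t]]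
    by (simp add: case_prod_unfold scaleR_add_right add_ac)
  moreover have "\<exists>C. \<forall>u t. \<bar>u\<bar> ^ a * norm (D b c u t + E b c u t) \<le> C" for a b c
  proof -
    obtain C C' where C: "\<And>u t. \<bar>u\<bar> ^ a * norm (D b c u t) \<le> C"
        "\<And>u t. \<bar>u\<bar> ^ a * norm (E b c u t) \<le> C'"
      using D(4)[of a b c] E(4)[of a b c] by blast
    have "\<bar>u\<bar> ^ a * norm (D b c u t + E b c u t) \<le> C + C'" for u t
    proof -
      have "\<bar>u\<bar> ^ a * norm (D b c u t + E b c u t) \<le> \<bar>u\<bar> ^ a * (norm (D b c u t) + norm (E b c u t))"
        by (intro mult_left_mono norm_triangle_ineq) auto
      also have "\<dots> \<le> C + C'"
        using C[of u t] by (simp add: distrib_left)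
      finally show ?thesis .
    qed
    then show ?thesis by blast
  qed
  ultimately show ?thesis
    unfolding schwartz_cyl_def using D(1,2) E(1,2)
    by (intro CollectI conjI allI exI[of _ "\<lambda>b c u t. D b c u t + E b c u t"]) auto
qed

text \<open>A \<open>t\<close>-derivative multiplies by the constant \<open>z\<close> and a
  \<open>u\<close>-derivative acts on \<open>f\<close> alone, so all mixed partials are explicit.
  Powers of \<open>W\<close> have modulus 1, hence decay reduces to continuity on a compact interval
  and vanishing outside it.\<close>

lemma schwartz_cyl_test_function:
  assumes "test_function f"
  shows "(\<lambda>u t. complex_of_real (f u) * W t powi m) \<in> schwartz_cyl"
proof -
  obtain D R where D: "D 0 = f" "\<And>k x. (D k has_real_derivative D (Suc k) x) (at x)"
    "\<And>k x. R < \<bar>x\<bar> \<Longrightarrow> D k x = 0"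
    using assms unfolding test_function_def by auto
  define z where "z = 2 * pi * \<i> * of_int m"
  define E where "E b c u t = of_real (D b u) * (z ^ c * W t powi m)" for b c :: nat and u t
  have der: "((\<lambda>(x, y). E b c x y) has_derivative
      (\<lambda>(k, l). k *\<^sub>R E (Suc b) c u t + l *\<^sub>R E b (Suc c) u t)) (at (u, t))" for b c u t
  proof -
    have "((\<lambda>p. D b (fst p)) has_derivative (\<lambda>p. fst p * D (Suc b) u)) (at (u, t))"
      using has_derivative_compose[OF has_derivative_fst[OF has_derivative_ident],
          of "D b" "\<lambda>k. k * D (Suc b) u" "(u, t)"] D(2)[of b u]
      by (simp add: has_field_derivative_def mult_commute_abs)
    then have 1: "((\<lambda>p. complex_of_real (D b (fst p))) has_derivative
        (\<lambda>p. of_real (fst p * D (Suc b) u))) (at (u, t))"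
      by (rule has_derivative_of_real)
    have 2: "((\<lambda>p. W (snd p) powi m) has_derivative (\<lambda>p. snd p *\<^sub>R (z * W t powi m))) (at (u, t))"
      using has_derivative_compose[OF has_derivative_snd[OF has_derivative_ident],
          of "\<lambda>t. W t powi m" "\<lambda>l. l *\<^sub>R (z * W t powi m)" "(u, t)"]
        has_vector_derivative_W_powi[of m t UNIV]
      by (simp add: has_vector_derivative_def z_def)
    show ?thesis
      unfolding E_def case_prod_unfold
      by (rule has_derivative_eq_rhs[OF has_derivative_mult[OF 1 has_derivative_mult_right[OF 2]]])
        (auto simp: fun_eq_iff scaleR_conv_of_real algebra_simps)
  qed
  have bound: "\<exists>C. \<forall>u t. \<bar>u\<bar> ^ a * norm (E b c u t) \<le> C" for a b c
  proof -
    have "continuous_on {-R..R} (\<lambda>u. \<bar>u\<bar> ^ a * \<bar>D b u\<bar>)"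
      using D(2) DERIV_continuous_on[of "{-R..R}" "D b" "D (Suc b)"]
      by (intro continuous_intros) (blast intro: has_field_derivative_at_within)
    then have "bounded ((\<lambda>u. \<bar>u\<bar> ^ a * \<bar>D b u\<bar>) ` {-R..R})"
      by (intro compact_imp_bounded compact_continuous_image) auto
    then obtain B where B: "\<forall>u\<in>{-R..R}. \<bar>u\<bar> ^ a * \<bar>D b u\<bar> \<le> B" "B > 0"
      unfolding bounded_pos by (auto simp: abs_mult)
    have B': "\<bar>u\<bar> ^ a * \<bar>D b u\<bar> \<le> B" for u
      using B D(3)[of u b] by (cases "u \<in> {-R..R}") auto
    have "\<bar>u\<bar> ^ a * norm (E b c u t) \<le> B * norm z ^ c" for u t
    proof -
      have "norm (W t powi m) = 1"
        unfolding W_powi by (rule norm_exp_i_times)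
      then have "\<bar>u\<bar> ^ a * norm (E b c u t) = \<bar>u\<bar> ^ a * \<bar>D b u\<bar> * norm z ^ c"
        by (simp add: E_def norm_mult norm_power)
      then show ?thesis using B'[of u] by (simp only: mult_right_mono norm_ge_zero zero_le_power)
    qed
    then show ?thesis by blast
  qed
  have "E 0 0 = (\<lambda>u t. complex_of_real (f u) * W t powi m)"
    by (simp add: fun_eq_iff E_def D(1))
  then show ?thesis
    unfolding schwartz_cyl_def
    using der bound by (intro CollectI conjI allI exI[of _ E]) (auto simp: W_shift)
qed

section \<open>Integrals of compactly supported functions and sums of translates\<close>

lemma has_bochner_integral_deriv_zero:
  fixes K k :: "real \<Rightarrow> real"
  assumes "\<And>x. (K has_real_derivative k x) (at x)" "continuous_on UNIV k"
    and zero: "\<And>x. R < \<bar>x\<bar> \<Longrightarrow> K x = 0" "\<And>x. R < \<bar>x\<bar> \<Longrightarrow> k x = 0"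
  shows "has_bochner_integral lborel k 0"
proof -
  \<comment> \<open>Positive, so the interval is not reversed, and larger than \<open>R\<close>, so
    \<open>K\<close> vanishes at both endpoints.\<close>
  let ?S = "\<bar>R\<bar> + 1"
  have "has_bochner_integral lborel (\<lambda>x. k x * indicator {-?S..?S} x) (K ?S - K (-?S))"
    using assms(1,2) by (intro has_bochner_integral_FTC_Icc_real)
      (auto simp: continuous_on_eq_continuous_at)
  moreover have "(\<lambda>x. k x * indicator {-?S..?S} x) = k"
  proof
    show "k x * indicator {-?S..?S} x = k x" for x
      using zero(2)[of x] by (cases "R < \<bar>x\<bar>") (auto simp: indicator_def)
  qed
  ultimately show ?thesis using zero(1) by simp
qed

lemma integrable_continuous_compact_support:
  fixes k :: "real \<Rightarrow> real"
  assumes "continuous_on UNIV k" and zero: "\<And>x. R < \<bar>x\<bar> \<Longrightarrow> k x = 0"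
  shows "integrable lborel k"
proof -
  have "integrable lborel (\<lambda>x. indicator {-R..R} x *\<^sub>R k x)"
    using assms(1) by (intro borel_integrable_compact) (auto intro: continuous_on_subset)
  moreover have "(\<lambda>x. indicator {-R..R} x *\<^sub>R k x) = k"
  proof
    show "indicator {-R..R} x *\<^sub>R k x = k x" for x
      using zero[of x] by (cases "R < \<bar>x\<bar>") (auto simp: indicator_def)
  qed
  ultimately show ?thesis by simp
qed

text \<open>The \<open>k\<close>-th translate lives on \<open>[2kh, 2kh + 2h]\<close>. Distinct
  intervals of this kind meet at most in endpoints, where \<open>q\<close> vanishes, so only
  \<open>k = j\<close> can contribute.\<close>

lemma sum_translates:
  fixes q :: "real \<Rightarrow> real" and j :: int and h s :: real
  assumes zero: "\<And>x. x \<le> 0 \<or> 2 * h \<le> x \<Longrightarrow> q x = 0" and "0 \<le> s" "s \<le> 2 * h"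
  shows "(\<Sum>k=1..n. q (2 * j * h + s - 2 * real k * h)) = (if 1 \<le> j \<and> j \<le> int n then q s else 0)"
proof -
  have h: "0 \<le> h" using assms(2,3) by linarith
  \<comment> \<open>\<open>nat\<close> sends every nonpositive \<open>j\<close> to 0, which
    \<open>1 \<le> k\<close> excludes, so \<open>nat j = k\<close> means
    \<open>j = int k\<close>.\<close>
  have "q (2 * j * h + s - 2 * real k * h) = (if nat j = k then q s else 0)" if "1 \<le> k" for k
  proof -
    consider "j = int k" | "j \<le> int k - 1" | "j \<ge> int k + 1" by linarith
    then show ?thesis
    proof cases
      case 2
      then have "real_of_int j \<le> real k - 1" by linarith
      then have "real_of_int j * h \<le> (real k - 1) * h" using h by (rule mult_right_mono)
      then have "q (2 * j * h + s - 2 * real k * h) = 0"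
        using assms(3) by (intro zero) (simp add: algebra_simps)
      then show ?thesis using 2 that by auto
    next
      case 3
      then have "real_of_int j \<ge> real k + 1" by linarith
      then have "real_of_int j * h \<ge> (real k + 1) * h" using h by (rule mult_right_mono)
      then have "q (2 * j * h + s - 2 * real k * h) = 0"
        using assms(2) by (intro zero) (simp add: algebra_simps)
      then show ?thesis using 3 that by auto
    qed simp
  qed
  then have "(\<Sum>k=1..n. q (2 * j * h + s - 2 * real k * h)) = (\<Sum>k=1..n. if nat j = k then q s else 0)"
    by (intro sum.cong) auto
  then show ?thesis by (auto simp: nat_le_iff Suc_le_eq)
qed

text \<open>Generic in \<open>F\<close> and \<open>G\<close>, so that inserting their derivatives
  yields the coefficients of \<open>deriv1\<close> of the projection.\<close>

definition proj_coef :: "real \<Rightarrow> (real \<Rightarrow> real) \<Rightarrow> (real \<Rightarrow> real) \<Rightarrow> int \<Rightarrow> real \<Rightarrow> real" where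
  "proj_coef h F G m u =
     (if m = 1 then G (u + h) else if m = 0 then F u else if m = - 1 then G u else 0)"

lemma band_limited_proj_coef: "band_limited 1 (\<lambda>m u. complex_of_real (proj_coef h F G m u))"
  by (auto simp: band_limited_def proj_coef_def)

lemma Icc_1: "{-1..1::int} = {-1, 0, 1}"
  by auto

lemma Icc_2: "{-2..2::int} = {-2, -1, 0, 1, 2}"
  by auto

section \<open>The bump functions block by block and the projection relations\<close>

locale bump =
  fixes h :: real and \<phi> :: "real \<Rightarrow> real" and n :: nat
  assumes h: "h > 0" and \<phi>_mono: "mono_on {0..h} \<phi>" and \<phi>_0: "\<phi> 0 = 0" and \<phi>_h: "\<phi> h = 1"
    and smooth_f: "smooth_on UNIV (bump_f h \<phi>)" and smooth_g: "smooth_on UNIV (bump_g h \<phi>)"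
begin

abbreviation "F \<equiv> sum_f h \<phi> n"
abbreviation "G \<equiv> sum_g h \<phi> n"

text \<open>Marks the intervals \<open>[2jh, 2jh + 2h]\<close> that carry a translate. Integer
  indices let these intervals cover the line, so the empty ones need no separate argument.\<close>

definition block :: "int \<Rightarrow> real" where
  "block j = (if 1 \<le> j \<and> j \<le> int n then 1 else 0)"

lemma block_cases: "block j = 0 \<or> block j = 1"
  by (simp add: block_def)

lemma \<phi>_bounds: "0 \<le> r \<Longrightarrow> r \<le> h \<Longrightarrow> 0 \<le> \<phi> r \<and> \<phi> r \<le> 1"
  using mono_onD[OF \<phi>_mono, of 0 r] mono_onD[OF \<phi>_mono, of r h] \<phi>_0 \<phi>_h by auto

text \<open>Ensures that squaring the root in \<open>bump_g\<close> gives back the radicand.\<close>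

lemma \<phi>_diff_square_nonneg: "0 \<le> r \<Longrightarrow> r \<le> h \<Longrightarrow> 0 \<le> \<phi> r - (\<phi> r)\<^sup>2"
  using \<phi>_bounds[of r] mult_left_le[of "\<phi> r" "\<phi> r"] by (simp add: power2_eq_square)

lemma F_value:
  assumes "0 \<le> s" "s \<le> 2 * h"
  shows "F (2 * of_int j * h + s) = block j * bump_f h \<phi> s"
proof -
  have "bump_f h \<phi> x = 0" if "x \<le> 0 \<or> 2 * h \<le> x" for x
    using that by (simp add: bump_f_def)
  from sum_translates[where q = "bump_f h \<phi>", OF this assms] show ?thesis
    by (simp add: sum_f_def block_def)
qed

lemma G_value:
  assumes "0 \<le> s" "s \<le> 2 * h"
  shows "G (2 * of_int j * h + s) = block j * bump_g h \<phi> s"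
proof -
  have "bump_g h \<phi> x = 0" if "x \<le> 0 \<or> 2 * h \<le> x" for x
    using that h by (auto simp: bump_g_def)
  from sum_translates[where q = "bump_g h \<phi>", OF this assms] show ?thesis
    by (simp add: sum_g_def block_def)
qed

context
  fixes j :: int and r u :: real
  assumes r: "0 \<le> r" "r \<le> h"
begin

text \<open>The point enters through an equation, so that these rules also apply to the translates
  \<open>u - h\<close> and \<open>u + h\<close>.\<close>

lemma F_left: "u = 2 * of_int j * h + r \<Longrightarrow> F u = block j * \<phi> r"
  using F_value[of r j] r h \<phi>_0 by (auto simp: bump_f_def)

lemma F_right: "u = 2 * of_int j * h + h + r \<Longrightarrow> F u = block j * (1 - \<phi> r)"
  using F_value[of "h + r" j] r h \<phi>_0 \<phi>_h by (auto simp: bump_f_def add.assoc)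

lemma G_left: "u = 2 * of_int j * h + r \<Longrightarrow> G u = 0"
  using G_value[of r j] r h by (auto simp: bump_g_def)

text \<open>Here the bump equals \<open>1 - \<phi> r\<close>, and \<open>x - x^2\<close> is
  invariant under replacing \<open>x\<close> by \<open>1 - x\<close>.\<close>

lemma G_right: "u = 2 * of_int j * h + h + r \<Longrightarrow> G u = block j * sqrt (\<phi> r - (\<phi> r)\<^sup>2)"
  using G_value[of "h + r" j] r h \<phi>_0 \<phi>_h
  by (auto simp: bump_g_def bump_f_def add.assoc power2_eq_square algebra_simps)

end

lemma half_block_cases:
  obtains (left) j :: int and r where "0 \<le> r" "r \<le> h" "u = 2 * of_int j * h + r"
  | (right) j :: int and r where "0 \<le> r" "r \<le> h" "u = 2 * of_int j * h + h + r"
proof -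
  define j where "j = \<lfloor>u / (2 * h)\<rfloor>"
  have "of_int j \<le> u / (2 * h)" "u / (2 * h) < of_int j + 1"
    unfolding j_def by linarith+
  then have "2 * of_int j * h \<le> u" "u \<le> 2 * of_int j * h + 2 * h"
    using h by (simp_all add: field_simps)
  then show ?thesis
    using left[of "u - 2 * of_int j * h" j] right[of "u - 2 * of_int j * h - h" j]
    by (cases "u - 2 * of_int j * h \<le> h") auto
qed

text \<open>\<open>G\<close> vanishes on left halves. From a right half, translation by
  \<open>-h\<close> leads to the left half of the same block with the same \<open>r\<close>, where
  the values \<open>\<phi> r\<close> and \<open>1 - \<phi> r\<close> add up to 1.\<close>

lemma G_partition: "G u * (F u + F (u - h)) = G u"
proof (cases rule: half_block_cases[of u])
  case (left j r)
  then show ?thesis using G_left[of r u j] by simp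
next
  case (right j r)
  then have "u - h = 2 * of_int j * h + r" by simp
  then show ?thesis
    using F_left[OF right(1,2), of "u - h" j] F_right[OF right] G_right[OF right] block_cases[of j]
    by auto
qed

text \<open>Translation by \<open>h\<close> moves a right half to the left half of the next block,
  where \<open>G\<close> vanishes.\<close>

lemma G_disjoint: "G u * G (u + h) = 0"
proof (cases rule: half_block_cases[of u])
  case (left j r)
  then show ?thesis using G_left[of r u j] by simp
next
  case (right j r)
  then have "u + h = 2 * of_int (j + 1) * h + r" by (simp add: algebra_simps)
  then show ?thesis using G_left[OF right(1,2), of "u + h" "j + 1"] by simp
qed

text \<open>On a left half only \<open>G (u + h)\<close> can be nonzero, on a right half only
  \<open>G u\<close>. In both cases its square is \<open>F u - (F u)^2\<close>.\<close>

lemma F_G_square: "(F u)\<^sup>2 + (G (u + h))\<^sup>2 + (G u)\<^sup>2 = F u"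
proof (cases rule: half_block_cases[of u])
  case (left j r)
  then have u: "u + h = 2 * of_int j * h + h + r" by simp
  show ?thesis
    using F_left[OF left] G_left[OF left] G_right[OF left(1,2) u] block_cases[of j]
      \<phi>_diff_square_nonneg[OF left(1,2)] by auto
next
  case (right j r)
  then have u: "u + h = 2 * of_int (j + 1) * h + r" by (simp add: algebra_simps)
  show ?thesis
    using F_right[OF right] G_right[OF right] G_left[OF right(1,2) u] block_cases[of j]
      \<phi>_diff_square_nonneg[OF right(1,2)] by (auto simp: power2_diff)
qed

section \<open>Smoothness of \<open>F\<close> and \<open>G\<close> and the integral of the index
  density\<close>

lemma test_function_F: "test_function F"
proof -
  have "test_function (bump_f h \<phi>)"
    using smooth_f h by (intro test_functionI[of _ "2 * h"]) (auto simp: bump_f_def)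
  then have "test_function (\<lambda>u. \<Sum>k=1..n. bump_f h \<phi> (u + (- 2 * real k * h)))"
    by (intro test_function_sum test_function_shift)
  then show ?thesis by (simp add: sum_f_def[abs_def])
qed

lemma test_function_G: "test_function G"
proof -
  have "test_function (bump_g h \<phi>)"
    using smooth_g h by (intro test_functionI[of _ "2 * h"]) (auto simp: bump_g_def)
  then have "test_function (\<lambda>u. \<Sum>k=1..n. bump_g h \<phi> (u + (- 2 * real k * h)))"
    by (intro test_function_sum test_function_shift)
  then show ?thesis by (simp add: sum_g_def[abs_def])
qed

text \<open>\<open>G\<close> lives on the right halves of the blocks, where \<open>G\<^sup>2 = F - F\<^sup>2\<close> and \<open>F\<close> decreases from
  1 to 0, so that each block contributes \<open>\<integral>\<^sub>1\<^sup>0 (x - x\<^sup>2) dx = - 1 / 6\<close>.\<close>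

lemma has_integral_G_square_deriv_F:
  assumes der: "\<And>x. (F has_real_derivative F' x) (at x)" and cont: "continuous_on UNIV F'"
  shows "has_bochner_integral lborel (\<lambda>u. (G u)\<^sup>2 * F' u) (- (real n / 6))"
proof -
  let ?I = "\<lambda>k::nat. {2 * real k * h + h..2 * real k * h + 2 * h}"
  have contF: "continuous_on UNIV F"
    using der by (rule DERIV_continuous_on)
  have "has_bochner_integral lborel (\<lambda>u. ((F u - (F u)\<^sup>2) * F' u) * indicator (?I k) u) (- 1 / 6)"
    if k: "k \<in> {1..n}" for k
  proof -
    let ?K = "\<lambda>u. (F u)\<^sup>2 / 2 - (F u) ^ 3 / 3"
    have "F (2 * real k * h + h) = 1" "F (2 * real k * h + 2 * h) = 0"
      using F_right[of 0 "2 * real k * h + h" "int k"] F_right[of h "2 * real k * h + 2 * h" "int k"]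
        k h \<phi>_0 \<phi>_h by (auto simp: block_def)
    moreover have "has_bochner_integral lborel (\<lambda>u. ((F u - (F u)\<^sup>2) * F' u) * indicator (?I k) u)
        (?K (2 * real k * h + 2 * h) - ?K (2 * real k * h + h))"
    proof (rule has_bochner_integral_FTC_Icc_real)
      show "(?K has_real_derivative (F u - (F u)\<^sup>2) * F' u) (at u)" for u
        by (auto intro!: derivative_eq_intros der simp: power2_eq_square algebra_simps)
      have "continuous_on UNIV (\<lambda>u. (F u - (F u)\<^sup>2) * F' u)"
        by (intro continuous_intros cont contF)
      then show "isCont (\<lambda>u. (F u - (F u)\<^sup>2) * F' u) u" for u
        by (simp add: continuous_on_eq_continuous_at)
    qed (use h in simp)
    ultimately show ?thesis by simp
  qed
  then have "has_bochner_integral lborel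
      (\<lambda>u. \<Sum>k\<in>{1..n}. ((F u - (F u)\<^sup>2) * F' u) * indicator (?I k) u) (\<Sum>k\<in>{1..n}. - 1 / 6)"
    by (rule has_bochner_integral_sum)
  moreover have "(\<Sum>k\<in>{1..n}. ((F u - (F u)\<^sup>2) * F' u) * indicator (?I k) u) = (G u)\<^sup>2 * F' u" for u
  proof (cases rule: half_block_cases[of u])
    case (left j r)
    have "((F u - (F u)\<^sup>2) * F' u) * indicator (?I k) u = 0" for k
    proof (cases "u \<in> ?I k")
      case True
      \<comment> \<open>A left half meets the closed interval \<open>?I k\<close> only in endpoints,
        where \<open>F\<close> is 0 or 1 and so \<open>F - F^2\<close> vanishes.\<close>
      have "r = 0 \<or> r = h"
      proof (rule ccontr)
        assume "\<not> (r = 0 \<or> r = h)"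
        then have "0 < r" "r < h" using left by auto
        moreover have "2 * (real_of_int j - real k) * h = u - r - 2 * real k * h"
          using left(3) by (simp add: algebra_simps)
        ultimately have "2 * (real_of_int j - real k) * h < 2 * h" "0 < 2 * (real_of_int j - real k) * h"
          using True by auto
        \<comment> \<open>The integer \<open>j - int k\<close> would lie strictly between 0 and
          1.\<close>
        then have "real_of_int (j - int k) < of_int 1" "of_int 0 < real_of_int (j - int k)"
          using h by (simp_all add: zero_less_mult_iff)
        then show False unfolding of_int_less_iff by linarith
      qed
      then show ?thesis
        using F_left[OF left] \<phi>_0 \<phi>_h block_cases[of j] by auto
    qed simp
    then have "(\<Sum>k\<in>{1..n}. ((F u - (F u)\<^sup>2) * F' u) * indicator (?I k) u) = 0"
      by (intro sum.neutral ballI)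
    then show ?thesis using G_left[OF left] by simp
  next
    case (right j r)
    have ind: "indicator (?I k) u = (if nat j = k then 1 else 0::real)" if "1 \<le> k" for k
    proof -
      have "u \<in> ?I k \<longleftrightarrow> j = int k"
      proof
        assume "u \<in> ?I k"
        moreover have "2 * (real_of_int j - real k) * h = u - r - h - 2 * real k * h"
          using right(3) by (simp add: algebra_simps)
        ultimately have "2 * (real_of_int j - real k) * h \<le> 1 * h" "(- 1) * h \<le> 2 * (real_of_int j - real k) * h"
          using right(1,2) by auto
        then have "2 * (real_of_int j - real k) \<le> 1" "- 1 \<le> 2 * (real_of_int j - real k)"
          using h by (simp_all only: mult_le_cancel_right_pos)
        \<comment> \<open>An even integer between -1 and 1 is zero.\<close>
        then have "real_of_int (2 * (j - int k)) \<le> of_int 1" "of_int (- 1) \<le> real_of_int (2 * (j - int k))"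
          by simp_all
        then show "j = int k" unfolding of_int_le_iff by presburger
      next
        assume "j = int k"
        then show "u \<in> ?I k" using right by auto
      qed
      then show ?thesis using that by (auto simp: indicator_def)
    qed
    have "(\<Sum>k\<in>{1..n}. ((F u - (F u)\<^sup>2) * F' u) * indicator (?I k) u) =
        (\<Sum>k\<in>{1..n}. if nat j = k then (F u - (F u)\<^sup>2) * F' u else 0)"
      by (intro sum.cong) (auto simp: ind)
    also have "\<dots> = block j * ((F u - (F u)\<^sup>2) * F' u)"
      by (auto simp: block_def nat_le_iff)
    also have "\<dots> = (G u)\<^sup>2 * F' u"
      using F_right[OF right] G_right[OF right] block_cases[of j]
        \<phi>_diff_square_nonneg[OF right(1,2)] by (auto simp: power2_diff)
    finally show ?thesis .
  qed
  ultimately have "has_bochner_integral lborel (\<lambda>u. (G u)\<^sup>2 * F' u) (\<Sum>k\<in>{1..n}. - 1 / 6)"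
    by (simp only:)
  then show ?thesis by simp
qed

text \<open>On the open set where \<open>G\<close> is nonzero, \<open>F x + F (x - h)\<close> is
  constantly 1 by \<open>G_partition\<close>, so its derivative vanishes. Elsewhere both sides are
  zero.\<close>

lemma deriv_F_antisymmetric:
  assumes der: "\<And>x. (F has_real_derivative F' x) (at x)"
  shows "(G u)\<^sup>2 * F' (u - h) = - ((G u)\<^sup>2 * F' u)"
proof (cases "G u = 0")
  case False
  obtain G' where G': "\<And>x. (G has_real_derivative G' x) (at x)"
    using test_functionE[OF test_function_G] by metis
  then have "continuous_on UNIV G" by (rule DERIV_continuous_on)
  then have op: "open {x. G x \<noteq> 0}"
    by (intro open_Collect_neq continuous_on_const)
  have one: "1 = F x + F (x - h)" if "x \<in> {x. G x \<noteq> 0}" for x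
    using G_partition[of x] that by simp
  have "((\<lambda>x. F x + F (x - h)) has_real_derivative 0) (at u)"
    by (rule has_field_derivative_transform_within_open[OF DERIV_const op _ one]) (use False in simp)
  moreover have "((\<lambda>x. F x + F (x - h)) has_real_derivative F' u + F' (u - h)) (at u)"
    using der[of "u - h"] DERIV_shift[of F "F' (u - h)" u "- h"] by (intro DERIV_add der) simp
  ultimately have "F' u + F' (u - h) = 0"
    using DERIV_unique by blast
  then show ?thesis by algebra
qed simp

text \<open>The integrand of \<open>\<Psi>(p\<^sub>n, p\<^sub>n, p\<^sub>n)\<close>. The parenthesised part is, at \<open>u + \<hbar>\<close>, of the same shape
  as the first line with \<open>F(u)\<close> and \<open>F(u - \<hbar>)\<close> exchanged.\<close>

definition index_density :: "(real \<Rightarrow> real) \<Rightarrow> (real \<Rightarrow> real) \<Rightarrow> real \<Rightarrow> real" where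
  "index_density F' G' u =
     2 * F u * G u * G' u + (G u)\<^sup>2 * F' (u - h) - (G u)\<^sup>2 * F' u
     - (2 * F u * G (u + h) * G' (u + h) + (G (u + h))\<^sup>2 * F' (u + h) - (G (u + h))\<^sup>2 * F' u)"

lemma integral_index_density:
  assumes F': "\<And>x. (F has_real_derivative F' x) (at x)" "continuous_on UNIV F'"
    and G': "\<And>x. (G has_real_derivative G' x) (at x)" "continuous_on UNIV G'"
  shows "(LINT u|lborel. index_density F' G' u) = real n"
proof -
  define A where "A u = 2 * F u * G u * G' u + (G u)\<^sup>2 * F' (u - h) - (G u)\<^sup>2 * F' u" for u
  define B where "B u = 2 * F (u - h) * G u * G' u + (G u)\<^sup>2 * F' u - (G u)\<^sup>2 * F' (u - h)" for u
  obtain R where R: "\<And>x. R < \<bar>x\<bar> \<Longrightarrow> G x = 0"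
    using test_functionE[OF test_function_G] by metis
  have cont: "continuous_on UNIV F" "continuous_on UNIV G"
    using F' G' by (blast intro: DERIV_continuous_on)+
  have cont_sub: "continuous_on UNIV (\<lambda>u. F (u - h))" "continuous_on UNIV (\<lambda>u. F' (u - h))"
    by (intro continuous_on_compose2[OF cont(1)] continuous_on_compose2[OF F'(2)] continuous_intros; simp)+
  have int: "integrable lborel A" "integrable lborel B"
    unfolding A_def B_def
    by (rule integrable_continuous_compact_support[where R = R];
        use R in \<open>auto intro!: continuous_intros cont cont_sub F' G'\<close>)+
  have intB: "(LINT u|lborel. B (u + h)) = (LINT u|lborel. B u)" "integrable lborel (\<lambda>u. B (u + h))"
    using lborel_integral_real_affine[of 1 B h] lborel_integrable_real_affine[OF int(2), of 1 h]
    by (simp_all add: add.commute)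
  \<comment> \<open>The total derivative. Its primitive carries the factor \<open>G^2\<close>, hence
    has compact support and contributes 0.\<close>
  have der: "((\<lambda>u. (F u - F (u - h)) * (G u)\<^sup>2) has_real_derivative
      (F' u - F' (u - h)) * (G u)\<^sup>2 + (F u - F (u - h)) * (2 * G u * G' u)) (at u)" for u
    using DERIV_shift[of F "F' (u - h)" u "- h"]
    by (auto intro!: derivative_eq_intros F' G')
  have "has_bochner_integral lborel
      (\<lambda>u. (F' u - F' (u - h)) * (G u)\<^sup>2 + (F u - F (u - h)) * (2 * G u * G' u)) 0"
    by (rule has_bochner_integral_deriv_zero[where R = R, OF der])
      (use R in \<open>auto intro!: continuous_intros cont cont_sub F' G'\<close>)
  from has_bochner_integral_diff[OF this
      has_bochner_integral_mult_right[OF has_integral_G_square_deriv_F[OF F'], of 6]]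
  have "has_bochner_integral lborel
      (\<lambda>u. (F' u - F' (u - h)) * (G u)\<^sup>2 + (F u - F (u - h)) * (2 * G u * G' u)
        - 6 * ((G u)\<^sup>2 * F' u)) (real n)"
    by simp
  \<comment> \<open>\<open>A - B\<close> is the total derivative minus
    \<open>3 * G^2 * (F' u - F' (u - h))\<close>; antisymmetry doubles the first term, whence the
    factor 6.\<close>
  moreover have "(F' u - F' (u - h)) * (G u)\<^sup>2 + (F u - F (u - h)) * (2 * G u * G' u)
      - 6 * ((G u)\<^sup>2 * F' u) = A u - B u" for u
    using deriv_F_antisymmetric[OF F'(1), of u] unfolding A_def B_def by (simp add: algebra_simps)
  ultimately have "(LINT u|lborel. A u - B u) = real n"
    by (simp add: has_bochner_integral_integral_eq)
  moreover have "index_density F' G' u = A u - B (u + h)" for u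
    by (simp add: index_density_def A_def B_def)
  ultimately show ?thesis using int intB by simp
qed

section \<open>The projection and the value of the cocycle\<close>

abbreviation "p_coef \<equiv> \<lambda>m u. complex_of_real (proj_coef h F G m u)"

lemma proj_p_eq_fourier_sum: "proj_p h \<phi> n = fourier_sum p_coef"
  unfolding fourier_sum_band_limited[OF band_limited_proj_coef]
  by (simp add: Icc_1 proj_p_def proj_coef_def fun_eq_iff)

lemma proj_p_schwartz: "proj_p h \<phi> n \<in> schwartz_cyl"
proof -
  have "(\<lambda>u t. (complex_of_real (G (u + h)) * W t powi 1 + complex_of_real (F u) * W t powi 0)
      + complex_of_real (G u) * W t powi (- 1)) \<in> schwartz_cyl"
    by (intro schwartz_cyl_add schwartz_cyl_test_function test_function_shift
        test_function_F test_function_G)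
  then show ?thesis by (simp add: proj_p_def)
qed

text \<open>Degrees 2 and -2 vanish by \<open>G_disjoint\<close>, degrees 1 and -1 follow from
  \<open>G_partition\<close>, and degree 0 is \<open>F_G_square\<close>.\<close>

lemma twisted_conv_proj_coef: "twisted_conv h 1 p_coef p_coef = p_coef"
proof (intro ext)
  fix m :: int and u :: real
  \<comment> \<open>Degrees 1 and 2 use the relations at \<open>u + h\<close>, degree -2 uses
    disjointness at \<open>u - h\<close>.\<close>
  have shifted: "G (u + h) * (F (u + h) + F u) = G (u + h)" "G (u + h) * G (u + h + h) = 0"
      "G (u - h) * G u = 0"
    using G_partition[of "u + h"] G_disjoint[of "u + h"] G_disjoint[of "u - h"] by simp_all
  note eqs = G_partition[of u] F_G_square[of u] shifted
  consider "m = 2" | "m = 1" | "m = 0" | "m = -1" | "m = -2" | "\<bar>m\<bar> > 2"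
    by linarith
  then show "twisted_conv h 1 p_coef p_coef m u = p_coef m u"
    by cases (use eqs in \<open>auto simp: twisted_conv_def Icc_1 proj_coef_def power2_eq_square
        algebra_simps simp flip: of_real_mult of_real_add\<close>)
qed

lemma is_projection_proj_p: "is_projection h (proj_p h \<phi> n)"
proof -
  have "cprod h (proj_p h \<phi> n) (proj_p h \<phi> n) = proj_p h \<phi> n"
    unfolding proj_p_eq_fourier_sum
      cprod_fourier_sum[OF band_limited_proj_coef band_limited_proj_coef] twisted_conv_proj_coef ..
  moreover have "cstar h (proj_p h \<phi> n) = proj_p h \<phi> n"
    unfolding proj_p_eq_fourier_sum cstar_fourier_sum[OF band_limited_proj_coef]
    \<comment> \<open>The coefficients are real, and the degree 1 coefficient
      \<open>G (u + h)\<close> is exactly the translate by \<open>h\<close> of the degree -1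
      coefficient.\<close>
    by (rule arg_cong[where f = fourier_sum]) (auto simp: fun_eq_iff proj_coef_def)
  ultimately show ?thesis
    using proj_p_schwartz by (simp add: is_projection_def)
qed

lemma Psi_proj_p: "Psi h (proj_p h \<phi> n) (proj_p h \<phi> n) (proj_p h \<phi> n) = of_nat n"
proof -
  obtain F' where F': "\<And>x. (F has_real_derivative F' x) (at x)" "continuous_on UNIV F'"
    using test_functionE[OF test_function_F] by metis
  obtain G' where G': "\<And>x. (G has_real_derivative G' x) (at x)" "continuous_on UNIV G'"
    using test_functionE[OF test_function_G] by metis
  define c1 where "c1 = (\<lambda>m u. complex_of_real (proj_coef h F' G' m u))"
  define c2 where "c2 = (\<lambda>m u. 2 * pi * \<i> * of_int m * p_coef m u)"
  have bl: "band_limited 1 p_coef" "band_limited 1 c1" "band_limited 1 c2"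
    using band_limited_proj_coef unfolding c1_def c2_def by (auto simp: band_limited_def)
  have "(proj_coef h F G m has_real_derivative proj_coef h F' G' m u) (at u)" for m u
  proof -
    have "((\<lambda>u. G (u + h)) has_real_derivative G' (u + h)) (at u)"
      using G'(1)[of "u + h"] by (simp add: DERIV_shift)
    then show ?thesis
      unfolding proj_coef_def[abs_def] using F'(1)[of u] G'(1)[of u]
      by (cases "m = 1"; cases "m = 0"; cases "m = - 1") auto
  qed
  then have "(p_coef m has_vector_derivative c1 m u) (at u)" for m u
    unfolding c1_def
    by (intro has_vector_derivative_of_real) (simp add: has_real_derivative_iff_has_vector_derivative)
  then have d1: "deriv1 (fourier_sum p_coef) = fourier_sum c1"
    by (rule deriv1_fourier_sum[OF bl(1)])
  have d2: "deriv2 (fourier_sum p_coef) = fourier_sum c2"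
    unfolding c2_def by (rule deriv2_fourier_sum[OF bl(1)])
  \<comment> \<open>The outer cut-off is 2 because the inner product of two factors of degree at
    most 1 has degree at most 2.\<close>
  define X where "X = twisted_conv h 2 (twisted_conv h 1 p_coef c1) c2"
  define Y where "Y = twisted_conv h 2 (twisted_conv h 1 p_coef c2) c1"
  have bl2: "band_limited 2 (twisted_conv h 1 p_coef c1)" "band_limited 2 (twisted_conv h 1 p_coef c2)"
    using band_limited_twisted_conv[OF bl(2), of 1 h p_coef]
      band_limited_twisted_conv[OF bl(3), of 1 h p_coef]
    by simp_all
  have bl3: "band_limited 3 X" "band_limited 3 Y"
    unfolding X_def Y_def
    using band_limited_twisted_conv[OF bl(3), of 2 h] band_limited_twisted_conv[OF bl(2), of 2 h]
    by simp_all
  \<comment> \<open>\<open>tau\<close> sees only degree 0. Each term contains \<open>c2\<close>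
    once, and its factor \<open>2 * pi * \<i>\<close> cancels the prefactor of
    \<open>Psi\<close>.\<close>
  have density: "X 0 u - Y 0 u = 2 * pi * \<i> * of_real (index_density F' G' u)" for u
    unfolding X_def Y_def twisted_conv_def Icc_1 Icc_2 c1_def c2_def proj_coef_def index_density_def
    by (simp add: power2_eq_square algebra_simps)
  have "band_limited 3 (\<lambda>m u. X m u - Y m u)"
    using bl3 by (simp add: band_limited_def)
  then have "Psi h (proj_p h \<phi> n) (proj_p h \<phi> n) (proj_p h \<phi> n) =
      1 / (2 * pi * \<i>) * (LINT u|lborel. X 0 u - Y 0 u)"
    unfolding Psi_def proj_p_eq_fourier_sum d1 d2 cprod_fourier_sum[OF bl(1) bl(2)]
      cprod_fourier_sum[OF bl(1) bl(3)] cprod_fourier_sum[OF bl2(1) bl(3)]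
      cprod_fourier_sum[OF bl2(2) bl(2)] X_def[symmetric] Y_def[symmetric]
      fourier_sum_diff[OF bl3] tau_def
    by (simp add: coef_fourier_sum)
  also have "\<dots> = of_nat n"
    unfolding density using integral_index_density[OF F' G'] by simp
  finally show ?thesis .
qed

end

theorem proposition3p3:
  fixes h :: real and n :: nat and \<phi> :: "real \<Rightarrow> real"
  assumes "h > 0" and "n \<ge> 1"
    and "smooth_on {0..h} \<phi>" and "mono_on {0..h} \<phi>" and "\<phi> 0 = 0" and "\<phi> h = 1"
    and "smooth_on UNIV (bump_f h \<phi>)" and "smooth_on UNIV (bump_g h \<phi>)"
  shows "is_projection h (proj_p h \<phi> n) \<and>
    Psi h (proj_p h \<phi> n) (proj_p h \<phi> n) (proj_p h \<phi> n) = of_nat n"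
proof -
  interpret bump h \<phi> n
    using assms by unfold_locales
  show ?thesis
    using is_projection_proj_p Psi_proj_p by blast
qed

end
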